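(* Let $\alpha,\beta,\gamma,v$ be compositions with $\ell(v)\leq\ell(\alpha)$. Then $C_{\alpha,\beta}^{\gamma}=C_{\alpha+v,\beta}^{\gamma+v}$.
   Context: A composition is a finite sequence $\alpha=(\alpha_1,\dots,\alpha_m)$ of positive integers; $\ell(\alpha)=m$ is its length and $|\alpha|=\sum_i\alpha_i$ its size. For compositions $\alpha$ and $v$, $\alpha+v$ denotes the componentwise sum, where the shorter vector is padded with zeros at the end. $\mathrm{NSym}$ is the free associative (noncommutative) $\mathbb{Q}$-algebra generated by $H_1,H_2,\dots$, with $H_i$ of degree $i$; set $H_0=1$ and $H_m=0$ for $m<0$, and for an integer vector $(a_1,\dots,a_k)$ write $H_{(a_1,\dots,a_k)}=H_{a_1}\cdots H_{a_k}$. For a composition $\alpha=(\alpha_1,\dots,\alpha_k)$ the immaculate function is $\mathfrak{S}_{\alpha}=\sum_{\sigma\in S_k}(-1)^{\sigma}H_{(\alpha_1+\sigma_1-1,\alpha_2+\sigma_2-2,\dots,\alpha_k+\sigma_k-k)}$; the $\mathfrak{S}_\alpha$ with $\alpha$ ranging over compositions of $n$ form a basis of the degree-$n$ part of $\mathrm{NSym}$ (with $\mathfrak{S}_{\emptyset}=1$). The structure constants $C_{\alpha,\beta}^{\gamma}$ are defined by $\mathfrak{S}_{\alpha}\mathfrak{S}_{\beta}=\sum_{\gamma}C_{\alpha,\beta}^{\gamma}\mathfrak{S}_{\gamma}$, the sum over compositions $\gamma$. *)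

theory Defs
  imports Complex_Main "HOL-Library.Poly_Mapping" "HOL-Combinatorics.Permutations"
begin

definition is_composition :: "nat list \<Rightarrow> bool" where
  "is_composition \<alpha> \<longleftrightarrow> (\<forall>a\<in>set \<alpha>. 0 < a)"

(* Componentwise sum, the shorter list being padded with zeros at the end. *)
fun comp_add :: "nat list \<Rightarrow> nat list \<Rightarrow> nat list" where
  "comp_add [] ys = ys"
| "comp_add xs [] = xs"
| "comp_add (x # xs) (y # ys) = (x + y) # comp_add xs ys"

(* The free monoid on 'a, written additively so that finitely supported functions on it
   (Poly_Mapping) carry the convolution product and hence form the free associative algebra. *)
datatype 'a word = Word (letters: "'a list")

instantiation word :: (type) monoid_add
begin

definition zero_word :: "'a word" where
  "zero_word = Word []"

definition plus_word :: "'a word \<Rightarrow> 'a word \<Rightarrow> 'a word" where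
  "plus_word u w = Word (letters u @ letters w)"

instance
  by standard (simp_all add: zero_word_def plus_word_def)

end

(* The free associative algebra over the rationals on the generators H_1, H_2, ...;
   the letter n :: nat stands for the generator H_(n+1). *)
type_synonym nsym = "nat word \<Rightarrow>\<^sub>0 rat"

definition scale_nsym :: "rat \<Rightarrow> nsym \<Rightarrow> nsym" where
  "scale_nsym c f = Poly_Mapping.map (\<lambda>x. c * x) f"

definition H :: "int \<Rightarrow> nsym" where
  "H m = (if m < 0 then 0
          else if m = 0 then 1
          else Poly_Mapping.single (Word [nat m - 1]) 1)"

definition H_vec :: "int list \<Rightarrow> nsym" where
  "H_vec as = prod_list (map H as)"

(* Positions are counted from 0, which does not affect the differences \<sigma>_i - i. *)
definition immaculate :: "nat list \<Rightarrow> nsym" where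
  "immaculate \<alpha> =
     (\<Sum>\<sigma> | \<sigma> permutes {..<length \<alpha>}.
        scale_nsym (of_int (sign \<sigma>))
          (H_vec (map (\<lambda>i. int (\<alpha> ! i) + int (\<sigma> i) - int i) [0..<length \<alpha>])))"

(* The coefficients of a product of two immaculate functions in the basis of the immaculate
   functions indexed by compositions. That this is a basis (i.e. that the finitely supported
   coefficient function described below exists and is unique) is a theorem about NSym. *)
definition immaculate_product_coeffs :: "nat list \<Rightarrow> nat list \<Rightarrow> (nat list \<Rightarrow>\<^sub>0 rat)" where
  "immaculate_product_coeffs \<alpha> \<beta> =
     (THE c. (\<forall>\<gamma>\<in>Poly_Mapping.keys c. is_composition \<gamma>) \<and>
        immaculate \<alpha> * immaculate \<beta> =
          (\<Sum>\<gamma>\<in>Poly_Mapping.keys c. scale_nsym (Poly_Mapping.lookup c \<gamma>) (immaculate \<gamma>)))"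

definition structure_const :: "nat list \<Rightarrow> nat list \<Rightarrow> nat list \<Rightarrow> rat" where
  "structure_const \<alpha> \<beta> \<gamma> = Poly_Mapping.lookup (immaculate_product_coeffs \<alpha> \<beta>) \<gamma>"

end

(* The right Pieri rule expands immaculate(alpha) * H_m as the sum of immaculate(gamma) over the gamma
   obtained from alpha by enlarging its parts and possibly appending one new part, with total
   increase m. Since no part shrinks, this rule commutes with adding v to the index as long as v is not
   longer than alpha. Iterating, right multiplication by any polynomial in the H_i, in particular by
   immaculate(beta), acts in the same way on alpha and on alpha + v. The coefficients can be compared
   because the immaculate functions of compositions are linearly independent: immaculate(gamma) is
   the monomial H_gamma plus lexicographically larger monomials. *)
theory Submission
  imports Defs "Jordan_Normal_Form.Determinant" "HOL-Library.List_Lexorder"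
begin

section \<open>Linear combinations in NSym\<close>

lemma lookup_scale_nsym [simp]:
  "Poly_Mapping.lookup (scale_nsym a f) w = a * Poly_Mapping.lookup f w"
  by (simp add: scale_nsym_def Poly_Mapping.map.rep_eq when_def)

interpretation nsym: vector_space scale_nsym
  by unfold_locales (auto intro!: poly_mapping_eqI simp: lookup_add algebra_simps)

lemma scale_nsym_mult_left: "scale_nsym a f * g = scale_nsym a (f * g)"
  by (simp add: scale_nsym_def mult_map_scale_conv_mult mult.assoc)

lemma poly_mapping_sum_singles:
  "f = (\<Sum>w\<in>Poly_Mapping.keys f. Poly_Mapping.single w (Poly_Mapping.lookup f w))"
  by (rule poly_mapping_eqI)
    (auto simp: lookup_sum lookup_single when_def in_keys_iff)

text \<open>Scaling is multiplication by a multiple of the empty word. Such elements are central: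
  the empty word commutes with every word, and the coefficients commute.\<close>

lemma scale_nsym_mult_right: "f * scale_nsym a g = scale_nsym a (f * g)"
proof -
  have "f * Poly_Mapping.single 0 a = Poly_Mapping.single 0 a * f"
    by (subst (1 2) poly_mapping_sum_singles[of f])
      (simp add: sum_distrib_left sum_distrib_right mult_single mult.commute)
  then show ?thesis
    by (simp add: scale_nsym_def mult_map_scale_conv_mult flip: mult.assoc)
qed

text \<open>The shape of the expansion inside \<open>immaculate_product_coeffs\<close>, with the
  family left free.\<close>

definition lincomb :: "(nat list \<Rightarrow> nsym) \<Rightarrow> (nat list \<Rightarrow>\<^sub>0 rat) \<Rightarrow> nsym" where
  "lincomb S c = (\<Sum>\<gamma>\<in>Poly_Mapping.keys c. scale_nsym (Poly_Mapping.lookup c \<gamma>) (S \<gamma>))"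

text \<open>A common finite index set lets combinations with different supports be added term by
  term.\<close>

lemma lincomb_superset:
  assumes "finite K" "Poly_Mapping.keys c \<subseteq> K"
  shows "lincomb S c = (\<Sum>\<gamma>\<in>K. scale_nsym (Poly_Mapping.lookup c \<gamma>) (S \<gamma>))"
  unfolding lincomb_def using assms
  by (intro sum.mono_neutral_left) (auto simp: in_keys_iff)

lemma lincomb_zero [simp]: "lincomb S 0 = 0"
  by (simp add: lincomb_def)

lemma lincomb_single [simp]: "lincomb S (Poly_Mapping.single \<gamma> a) = scale_nsym a (S \<gamma>)"
  by (subst lincomb_superset[of "{\<gamma>}"]) auto

lemma lincomb_add: "lincomb S (c + d) = lincomb S c + lincomb S d"
  using keys_add[of c d]
  by (simp add: lincomb_superset[of "Poly_Mapping.keys c \<union> Poly_Mapping.keys d"] lookup_add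
      nsym.scale_left_distrib sum.distrib)

lemma lincomb_diff: "lincomb S (c - d) = lincomb S c - lincomb S d"
  by (metis add_diff_cancel_right' diff_add_cancel lincomb_add)

section \<open>Products of generators as monomials\<close>

lemma H_vec_append: "H_vec (as @ bs) = H_vec as * H_vec bs"
  by (simp add: H_vec_def)

text \<open>A negative index contributes the factor 0, a zero index the factor 1, and a positive
  index one letter. So a product of generators is either zero or a single monomial.\<close>

lemma H_vec_eq:
  "H_vec as = (if \<exists>a\<in>set as. a < 0 then 0
     else Poly_Mapping.single (Word (map (\<lambda>a. nat a - 1) (filter (\<lambda>a. a \<noteq> 0) as))) 1)"
proof (induction as)
  case Nil
  then show ?case
    by (simp add: H_vec_def single_one flip: zero_word_def)
next
  case (Cons a as)
  have "H_vec (a # as) = H a * H_vec as"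
    by (simp add: H_vec_def)
  with Cons.IH show ?case
    by (auto simp: H_def mult_single plus_word_def)
qed

section \<open>Linear independence of the immaculate functions\<close>

text \<open>Recovers a composition from its word, whose letters are shifted down by one; hence the
  word determines the composition.\<close>

lemma map_Suc_pred_composition: "is_composition \<gamma> \<Longrightarrow> map Suc (map (\<lambda>n. n - 1) \<gamma>) = \<gamma>"
  by (auto simp: is_composition_def intro!: map_idI)

text \<open>At the first position moved by \<open>\<sigma>\<close> the entry increases, and deleting zero entries does not affect
  the positive entries before it.\<close>

lemma immaculate_term_lex_greater:
  assumes comp: "is_composition \<gamma>" "is_composition \<delta>" and perm: "\<sigma> permutes {..<length \<delta>}"
    and as: "as = map (\<lambda>i. int (\<delta> ! i) + int (\<sigma> i) - int i) [0..<length \<delta>]"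
    and word: "map (\<lambda>a. nat a - 1) (filter (\<lambda>a. a \<noteq> 0) as) = map (\<lambda>n. n - 1) \<gamma>"
    and nonneg: "\<forall>a\<in>set as. 0 \<le> a" and "\<sigma> \<noteq> id"
  shows "\<delta> < \<gamma>"
proof -
  define i where "i = (LEAST i. \<sigma> i \<noteq> i)"
  have "\<exists>i. \<sigma> i \<noteq> i"
    using \<open>\<sigma> \<noteq> id\<close> by auto
  then have moved: "\<sigma> i \<noteq> i"
    unfolding i_def by (rule LeastI_ex)
  have fixed: "\<sigma> j = j" if "j < i" for j
    using not_less_Least[of j "\<lambda>i. \<sigma> i \<noteq> i"] that unfolding i_def by auto
  have i: "i < length \<delta>"
    using perm moved by (metis lessThan_iff permutes_not_in)
  \<comment> \<open>The smaller values are already taken by the fixed points before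
    \<open>i\<close>.\<close>
  have "\<sigma> i > i"
  proof (rule ccontr)
    assume "\<not> i < \<sigma> i"
    then have "\<sigma> i < i"
      using moved by simp
    then have "\<sigma> (\<sigma> i) = \<sigma> i"
      by (rule fixed)
    then show False
      using moved permutes_inj[OF perm] by (auto dest: injD)
  qed
  define x where "x = int (\<delta> ! i) + int (\<sigma> i) - int i"
  define bs where "bs = map (\<lambda>i. int (\<delta> ! i) + int (\<sigma> i) - int i) [Suc i..<length \<delta>]"
  have "[0..<length \<delta>] = [0..<i] @ i # [Suc i..<length \<delta>]"
    using i upt_add_eq_append[of 0 i "length \<delta> - i"] by (simp add: upt_conv_Cons)
  then have "as = map (\<lambda>j. int (\<delta> ! j) + int (\<sigma> j) - int j) [0..<i] @ x # bs"
    by (simp add: as x_def bs_def)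
  also have "map (\<lambda>j. int (\<delta> ! j) + int (\<sigma> j) - int j) [0..<i] = map int (take i \<delta>)"
    using i by (auto intro!: nth_equalityI simp: fixed)
  finally have as_split: "as = map int (take i \<delta>) @ x # bs" .
  have pos: "0 < n" if "n \<in> set (take i \<delta>)" for n
    using that comp(2) by (auto simp: is_composition_def dest: in_set_takeD)
  have x: "nat x > \<delta> ! i"
    using \<open>\<sigma> i > i\<close> by (simp add: x_def)
  have nat_x: "x \<noteq> 0" "Suc (nat x - 1) = nat x"
    using x by auto
  \<comment> \<open>Here \<open>\<gamma>\<close> is read back from its word. Since \<open>x\<close>
    is positive, it survives the deletion of zeros and stands in \<open>\<gamma>\<close> at position
    \<open>i\<close>, right after the unchanged parts of \<open>\<delta>\<close>.\<close>
  have "\<gamma> = map Suc (map (\<lambda>n. n - 1) \<gamma>)"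
    using comp(1) by (simp only: map_Suc_pred_composition)
  also have "\<dots> = map (\<lambda>a. Suc (nat a - 1)) (filter (\<lambda>a. a \<noteq> 0) as)"
    unfolding word[symmetric] by simp
  also have "\<dots> = map (\<lambda>a. Suc (nat a - 1)) (map int (take i \<delta>)) @
      map (\<lambda>a. Suc (nat a - 1)) (filter (\<lambda>a. a \<noteq> 0) (x # bs))"
    using pos unfolding as_split filter_append map_append
    by (subst filter_True) auto
  also have "map (\<lambda>a. Suc (nat a - 1)) (map int (take i \<delta>)) = take i \<delta>"
    using pos by (auto intro!: map_idI)
  finally obtain cs where "\<gamma> = take i \<delta> @ nat x # cs"
    using nat_x by (auto simp del: One_nat_def)
  moreover have "\<delta> = take i \<delta> @ \<delta> ! i # drop (Suc i) \<delta>"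
    by (rule id_take_nth_drop[OF i])
  ultimately show ?thesis
    using x unfolding list_less_def lexord_def by blast
qed

text \<open>Unitriangularity: a permutation other than the identity reaches only words of
  compositions larger than \<open>\<delta>\<close>, while the identity contributes the monomial of
  \<open>\<delta>\<close> itself.\<close>

lemma lookup_immaculate_le:
  assumes comp: "is_composition \<gamma>" "is_composition \<delta>" and "\<gamma> \<le> \<delta>"
  shows "Poly_Mapping.lookup (immaculate \<delta>) (Word (map (\<lambda>n. n - 1) \<gamma>)) = (if \<gamma> = \<delta> then 1 else 0)"
proof -
  define as where "as \<sigma> = map (\<lambda>i. int (\<delta> ! i) + int (\<sigma> i) - int i) [0..<length \<delta>]" for \<sigma>
  let ?w = "Word (map (\<lambda>n. n - 1) \<gamma>)"
  have vanish: "Poly_Mapping.lookup (H_vec (as \<sigma>)) ?w = 0"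
    if "\<sigma> permutes {..<length \<delta>}" "\<sigma> \<noteq> id" for \<sigma>
  proof (rule ccontr)
    assume "Poly_Mapping.lookup (H_vec (as \<sigma>)) ?w \<noteq> 0"
    then have "\<forall>a\<in>set (as \<sigma>). 0 \<le> a"
      and "map (\<lambda>a. nat a - 1) (filter (\<lambda>a. a \<noteq> 0) (as \<sigma>)) = map (\<lambda>n. n - 1) \<gamma>"
      by (auto simp: H_vec_eq lookup_single when_def not_less simp del: One_nat_def split: if_splits)
    then have "\<delta> < \<gamma>"
      by (intro immaculate_term_lex_greater[OF comp that(1) as_def _ _ that(2)])
    then show False
      using \<open>\<gamma> \<le> \<delta>\<close> by simp
  qed
  have "as id = map int \<delta>"
    by (auto simp: as_def intro!: nth_equalityI)
  moreover have "filter (\<lambda>a. a \<noteq> 0) (map int \<delta>) = map int \<delta>"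
    using comp(2) by (auto simp: is_composition_def)
  ultimately have "H_vec (as id) = Poly_Mapping.single (Word (map (\<lambda>n. n - 1) \<delta>)) 1"
    by (auto simp: H_vec_eq comp_def)
  moreover have "\<gamma> = \<delta>" if "map (\<lambda>n. n - 1) \<delta> = map (\<lambda>n. n - 1) \<gamma>"
    using that map_Suc_pred_composition comp by metis
  ultimately have "Poly_Mapping.lookup (H_vec (as id)) ?w = (if \<gamma> = \<delta> then 1 else 0)"
    by (auto simp: lookup_single when_def)
  moreover have "Poly_Mapping.lookup (immaculate \<delta>) ?w =
      (\<Sum>\<sigma> | \<sigma> permutes {..<length \<delta>}. of_int (sign \<sigma>) * Poly_Mapping.lookup (H_vec (as \<sigma>)) ?w)"
    by (simp add: immaculate_def lookup_sum as_def)
  moreover have "\<dots> = (\<Sum>\<sigma>\<in>{id}. of_int (sign \<sigma>) * Poly_Mapping.lookup (H_vec (as \<sigma>)) ?w)"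
    by (rule sum.mono_neutral_right) (auto simp: finite_permutations permutes_id vanish simp del: One_nat_def)
  ultimately show ?thesis
    by (simp add: sign_id)
qed

text \<open>At the word of the lexicographically least index in the support, unitriangularity leaves
  only the coefficient of that index.\<close>

lemma lincomb_immaculate_eq_0:
  assumes comp: "\<forall>\<gamma>\<in>Poly_Mapping.keys c. is_composition \<gamma>" and zero: "lincomb immaculate c = 0"
  shows "c = 0"
proof (rule ccontr)
  let ?\<gamma> = "Min (Poly_Mapping.keys c)"
  assume "c \<noteq> 0"
  then have \<gamma>: "?\<gamma> \<in> Poly_Mapping.keys c"
    by (intro Min_in) auto
  have "Poly_Mapping.lookup (lincomb immaculate c) (Word (map (\<lambda>n. n - 1) ?\<gamma>)) =
      (\<Sum>\<delta>\<in>Poly_Mapping.keys c. Poly_Mapping.lookup c \<delta> * (if ?\<gamma> = \<delta> then 1 else 0))"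
    unfolding lincomb_def lookup_sum lookup_scale_nsym
    by (rule sum.cong[OF refl]) (use \<gamma> comp in \<open>simp add: lookup_immaculate_le del: One_nat_def\<close>)
  also have "\<dots> = Poly_Mapping.lookup c ?\<gamma>"
    using \<gamma> by (simp add: sum.delta if_distrib cong: if_cong)
  finally show False
    using zero \<gamma> by (simp add: in_keys_iff)
qed

text \<open>Linear independence supplies the uniqueness demanded by \<open>THE\<close>, so the
  structure constants can be read off from any explicit expansion over compositions.\<close>

lemma structure_const_eq:
  assumes comp: "\<forall>\<gamma>\<in>Poly_Mapping.keys c. is_composition \<gamma>"
    and prod: "immaculate \<alpha> * immaculate \<beta> = lincomb immaculate c"
  shows "structure_const \<alpha> \<beta> \<gamma> = Poly_Mapping.lookup c \<gamma>"
proof -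
  have "immaculate_product_coeffs \<alpha> \<beta> = c"
    unfolding immaculate_product_coeffs_def lincomb_def[symmetric]
  proof (rule the_equality)
    fix d assume d: "(\<forall>\<gamma>\<in>Poly_Mapping.keys d. is_composition \<gamma>) \<and>
      immaculate \<alpha> * immaculate \<beta> = lincomb immaculate d"
    then have "lincomb immaculate (d - c) = 0"
      using prod by (simp add: lincomb_diff)
    moreover have "\<forall>\<gamma>\<in>Poly_Mapping.keys (d - c). is_composition \<gamma>"
      using d comp keys_diff[of d c] by blast
    ultimately have "d - c = 0"
      by (intro lincomb_immaculate_eq_0)
    then show "d = c"
      by simp
  qed (use assms in simp)
  then show ?thesis
    by (simp add: structure_const_def)
qed

section \<open>The right Pieri rule\<close>

text \<open>Subtracting neighbouring columns of the matrix \<open>[j \<le> c i]\<close>, whose last row is all ones, leaves the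
  matrix \<open>[j = c i]\<close> bordered by the last row \<open>(0, \<dots>, 0, 1)\<close>.\<close>

lemma sum_sign_permutes_below:
  fixes c :: "nat \<Rightarrow> int"
  shows "(\<Sum>\<sigma> | \<sigma> permutes {..<Suc k} \<and> (\<forall>i<k. int (\<sigma> i) \<le> c i). sign \<sigma>) =
         (\<Sum>\<sigma> | \<sigma> permutes {..<k} \<and> (\<forall>i<k. int (\<sigma> i) = c i). sign \<sigma>)"
proof -
  define A where "A = mat (Suc k) (Suc k) (\<lambda>(i, j). if i < k \<and> c i < int j then 0 else 1 :: int)"
  \<comment> \<open>Right multiplication by \<open>U\<close> subtracts from each column its right
    neighbour; the last column has none and stays, which gives the block \<open>C\<close>.\<close>
  define U where "U = mat (Suc k) (Suc k) (\<lambda>(i, j). if i = j then 1 else if i = Suc j then - 1 else 0 :: int)"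
  define B where "B = mat k k (\<lambda>(i, j). if c i = int j then 1 else 0 :: int)"
  define C where "C = mat k 1 (\<lambda>(i, j). A $$ (i, k))"
  have carrier: "A \<in> carrier_mat (Suc k) (Suc k)" "U \<in> carrier_mat (Suc k) (Suc k)"
    "B \<in> carrier_mat k k" "C \<in> carrier_mat k 1"
    by (simp_all add: A_def U_def B_def C_def)
  \<comment> \<open>Leibniz formula: a product of entries 0 and 1 is 1 exactly when the permutation
    satisfies every constraint.\<close>
  have sum_det: "(\<Sum>\<sigma> | \<sigma> permutes {..<n} \<and> (\<forall>i<n. P i (\<sigma> i)). sign \<sigma>) =
      det (mat n n (\<lambda>(i, j). if P i j then 1 else 0 :: int))" for n P
  proof -
    have "det (mat n n (\<lambda>(i, j). if P i j then 1 else 0 :: int)) =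
        (\<Sum>\<sigma> | \<sigma> permutes {..<n}. if \<forall>i<n. P i (\<sigma> i) then sign \<sigma> else 0)"
      unfolding det_def'[OF mat_carrier] atLeast0LessThan
    proof (rule sum.cong[OF refl])
      fix \<sigma> assume "\<sigma> \<in> {\<sigma>. \<sigma> permutes {..<n}}"
      then have "\<sigma> i < n" if "i < n" for i
        using that permutes_in_image[of \<sigma> "{..<n}" i] by simp
      then have "(\<Prod>i<n. mat n n (\<lambda>(i, j). if P i j then 1 else 0 :: int) $$ (i, \<sigma> i)) =
          (\<Prod>i<n. if P i (\<sigma> i) then 1 else 0)"
        by (intro prod.cong) auto
      also have "\<dots> = (if \<forall>i<n. P i (\<sigma> i) then 1 else 0)"
        by (auto intro!: prod_zero)
      finally show "of_int (sign \<sigma>) * (\<Prod>i<n. mat n n (\<lambda>(i, j). if P i j then 1 else 0) $$ (i, \<sigma> i)) =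
          (if \<forall>i<n. P i (\<sigma> i) then sign \<sigma> else 0)"
        by simp
    qed
    then show ?thesis
      by (simp add: sum.If_cases finite_permutations Collect_conj_eq Int_commute)
  qed
  have all_below: "(\<forall>i<Suc k. i < k \<longrightarrow> P i) \<longleftrightarrow> (\<forall>i<k. P i)" for P
    by auto
  have "A = mat (Suc k) (Suc k) (\<lambda>(i, j). if i < k \<longrightarrow> int j \<le> c i then 1 else 0)"
    by (auto simp: A_def)
  then have "det A = (\<Sum>\<sigma> | \<sigma> permutes {..<Suc k} \<and> (\<forall>i<Suc k. i < k \<longrightarrow> int (\<sigma> i) \<le> c i). sign \<sigma>)"
    using sum_det[of "Suc k" "\<lambda>i j. i < k \<longrightarrow> int j \<le> c i"] by simp
  then have det_A: "det A = (\<Sum>\<sigma> | \<sigma> permutes {..<Suc k} \<and> (\<forall>i<k. int (\<sigma> i) \<le> c i). sign \<sigma>)"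
    by (simp only: all_below)
  have "B = mat k k (\<lambda>(i, j). if int j = c i then 1 else 0)"
    by (auto simp: B_def)
  then have det_B: "det B = (\<Sum>\<sigma> | \<sigma> permutes {..<k} \<and> (\<forall>i<k. int (\<sigma> i) = c i). sign \<sigma>)"
    using sum_det[of k "\<lambda>i j. int j = c i"] by simp
  have "diag_mat U = replicate (Suc k) 1"
    by (auto simp: diag_mat_def U_def map_replicate_const simp del: upt_Suc replicate_Suc intro!: nth_equalityI)
  then have det_U: "det U = 1"
    by (subst det_lower_triangular[of "Suc k"]) (auto simp: U_def)
  \<comment> \<open>In a row \<open>i < k\<close> and a column \<open>j < k\<close> the difference
    of neighbouring entries is 1 exactly at \<open>j = c i\<close>, where \<open>j \<le> c i\<close>
    holds but \<open>j + 1 \<le> c i\<close> fails.\<close>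
  have "A * U = four_block_mat B C (0\<^sub>m 1 k) (1\<^sub>m 1)"
  proof (rule eq_matI)
    fix i j assume "i < dim_row (four_block_mat B C (0\<^sub>m 1 k) (1\<^sub>m 1))"
      and "j < dim_col (four_block_mat B C (0\<^sub>m 1 k) (1\<^sub>m 1))"
    then have ij: "i < Suc k" "j < Suc k"
      using carrier by auto
    have "(A * U) $$ (i, j) = (\<Sum>l<Suc k. A $$ (i, l) * U $$ (l, j))"
      using ij carrier by (simp add: scalar_prod_def atLeast0LessThan del: sum.lessThan_Suc)
    also have "\<dots> = (\<Sum>l<Suc k. (if l = j then A $$ (i, l) else 0) - (if l = Suc j then A $$ (i, l) else 0))"
      by (rule sum.cong[OF refl]) (use ij in \<open>auto simp: U_def\<close>)
    also have "\<dots> = A $$ (i, j) - (if Suc j < Suc k then A $$ (i, Suc j) else 0)"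
      using ij by (simp add: sum_subtractf del: sum.lessThan_Suc)
    also have "\<dots> = four_block_mat B C (0\<^sub>m 1 k) (1\<^sub>m 1) $$ (i, j)"
      using ij carrier
      by (auto simp: A_def B_def C_def less_Suc_eq)
    finally show "(A * U) $$ (i, j) = four_block_mat B C (0\<^sub>m 1 k) (1\<^sub>m 1) $$ (i, j)" .
  qed (use carrier in auto)
  then have "det A * det U = det B * det (1\<^sub>m 1)"
    using carrier by (simp add: det_mult[symmetric] det_four_block_mat_lower_left_zero)
  then show ?thesis
    using det_A det_B det_U by simp
qed

lemma sum_image_permutes:
  "\<sigma> permutes {..<k} \<Longrightarrow> (\<Sum>i<k. f (\<sigma> i)) = (\<Sum>i<k. f i)"
  by (simp add: sum.permute[of \<sigma> "{..<k}" f] comp_def)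

text \<open>For \<open>p = 0\<close>, only permutations fixing the last position contribute, as \<open>H m = 0\<close> for \<open>m < 0\<close>.\<close>

lemma immaculate_snoc:
  "immaculate (\<alpha> @ (if 0 < p then [p] else [])) =
    (\<Sum>\<sigma> | \<sigma> permutes {..<Suc (length \<alpha>)}. scale_nsym (of_int (sign \<sigma>))
      (H_vec (map (\<lambda>i. int (\<alpha> ! i) + int (\<sigma> i) - int i) [0..<length \<alpha>]) *
       H (int p + int (\<sigma> (length \<alpha>)) - int (length \<alpha>))))"
    (is "_ = (\<Sum>\<sigma> | \<sigma> permutes _. ?term \<sigma>)")
proof (cases "0 < p")
  case True
  have "map (\<lambda>i. int ((\<alpha> @ [p]) ! i) + int (\<sigma> i) - int i) [0..<Suc (length \<alpha>)] =
      map (\<lambda>i. int (\<alpha> ! i) + int (\<sigma> i) - int i) [0..<length \<alpha>] @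
      [int p + int (\<sigma> (length \<alpha>)) - int (length \<alpha>)]" for \<sigma>
    by (simp add: nth_append)
  moreover have "H_vec [a] = H a" for a
    by (simp add: H_vec_def)
  ultimately show ?thesis
    using True by (simp add: immaculate_def H_vec_append del: upt_Suc)
next
  case False
  let ?k = "length \<alpha>"
  have "(\<Sum>\<sigma> | \<sigma> permutes {..<?k}. ?term \<sigma>) = (\<Sum>\<sigma> | \<sigma> permutes {..<Suc ?k}. ?term \<sigma>)"
  proof (rule sum.mono_neutral_left)
    show "\<forall>\<sigma>\<in>{\<sigma>. \<sigma> permutes {..<Suc ?k}} - {\<sigma>. \<sigma> permutes {..<?k}}. ?term \<sigma> = 0"
    proof
      fix \<sigma> assume "\<sigma> \<in> {\<sigma>. \<sigma> permutes {..<Suc ?k}} - {\<sigma>. \<sigma> permutes {..<?k}}"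
      then have \<sigma>: "\<sigma> permutes {..<Suc ?k}" "\<not> \<sigma> permutes {..<?k}"
        by auto
      have "\<sigma> ?k \<noteq> ?k"
        using \<sigma> permutes_superset[of \<sigma> "{..<Suc ?k}" "{..<?k}"] by (auto simp: less_Suc_eq)
      moreover have "\<sigma> ?k < Suc ?k"
        using permutes_in_image[OF \<sigma>(1), of ?k] by simp
      ultimately show "?term \<sigma> = 0"
        using False by (simp add: H_def)
    qed
  qed (auto simp: finite_permutations intro: permutes_subset)
  moreover have "immaculate \<alpha> = (\<Sum>\<sigma> | \<sigma> permutes {..<?k}. ?term \<sigma>)"
    unfolding immaculate_def
  proof (rule sum.cong[OF refl])
    fix \<sigma> assume "\<sigma> \<in> {\<sigma>. \<sigma> permutes {..<?k}}"
    then have "\<sigma> ?k = ?k"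
      by (simp add: permutes_not_in)
    then have "H (int p + int (\<sigma> ?k) - int ?k) = 1"
      using False by (simp add: H_def)
    then show "scale_nsym (of_int (sign \<sigma>))
        (H_vec (map (\<lambda>i. int (\<alpha> ! i) + int (\<sigma> i) - int i) [0..<?k])) = ?term \<sigma>"
      by simp
  qed
  ultimately show ?thesis
    using False by simp
qed

section \<open>Finiteness and regrouping of the Pieri sums\<close>

lemma finite_lists_sum_le: "finite {ns :: nat list. length ns = k \<and> sum_list ns \<le> m}"
proof (rule finite_subset)
  show "{ns. length ns = k \<and> sum_list ns \<le> m} \<subseteq> {ns. set ns \<subseteq> {..m} \<and> length ns = k}"
    using member_le_sum_list by (fastforce intro: order_trans)
qed (simp add: finite_lists_length_eq)

text \<open>Collects equal exponent vectors, so that two signed sums can be compared one coefficient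
  at a time.\<close>

lemma sum_group_by:
  fixes W :: "'b \<Rightarrow> nsym"
  assumes "finite X" "finite B" "b ` X \<subseteq> B"
  shows "(\<Sum>x\<in>X. scale_nsym (s x) (W (b x))) = (\<Sum>y\<in>B. scale_nsym (\<Sum>x | x \<in> X \<and> b x = y. s x) (W y))"
proof -
  have "(\<Sum>x\<in>X. scale_nsym (s x) (W (b x))) = (\<Sum>y\<in>B. \<Sum>x | x \<in> X \<and> b x = y. scale_nsym (s x) (W (b x)))"
    using sum.group[OF assms, of "\<lambda>x. scale_nsym (s x) (W (b x))"] by simp
  also have "\<dots> = (\<Sum>y\<in>B. \<Sum>x | x \<in> X \<and> b x = y. scale_nsym (s x) (W y))"
    by (intro sum.cong refl) auto
  finally show ?thesis
    by (simp add: nsym.scale_sum_left)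
qed

text \<open>Both sides are compared coefficientwise at the products \<open>W y\<close>: the first \<open>k\<close> exponents \<open>y\<close> determine
  the last one by homogeneity. On the right, \<open>\<sigma>\<close> admits a (then unique) \<open>ns\<close> leading to \<open>y\<close> iff
  \<open>\<sigma> i \<le> y ! i - \<alpha> ! i + i\<close> for all \<open>i < k\<close>; on the left these must be equalities.\<close>

lemma immaculate_Pieri:
  "immaculate \<alpha> * H (int m) =
    (\<Sum>ns | length ns = length \<alpha> \<and> sum_list ns \<le> m.
      immaculate (map2 (+) \<alpha> ns @ (if sum_list ns < m then [m - sum_list ns] else [])))"
proof -
  define k where "k = length \<alpha>"
  define N where "N = {ns :: nat list. length ns = k \<and> sum_list ns \<le> m}"
  \<comment> \<open>The last index is chosen so that all indices add up to
    \<open>m + sum_list \<alpha>\<close>, the degree of the product.\<close>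
  define W where "W b = H_vec b * H (int m + int (sum_list \<alpha>) - sum_list b)" for b
  \<comment> \<open>\<open>b\<close> gives the first \<open>k\<close> exponents of a term on the
    left; \<open>b'\<close> gives those on the right, where a term is a choice of increments
    together with a permutation of \<open>k + 1\<close> positions.\<close>
  define b where "b \<sigma> = map (\<lambda>i. int (\<alpha> ! i) + int (\<sigma> i) - int i) [0..<k]" for \<sigma> :: "nat \<Rightarrow> nat"
  define b' where "b' = (\<lambda>(ns, \<sigma>). map (\<lambda>i. int (\<alpha> ! i) + int (ns ! i) + int (\<sigma> i) - int i) [0..<k])"
  define X where "X = {\<sigma>. \<sigma> permutes {..<k}}"
  define Y where "Y = N \<times> {\<sigma>. \<sigma> permutes {..<Suc k}}"
  define B where "B = b ` X \<union> b' ` Y"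
  have finite: "finite N" "finite X" "finite Y" "finite B"
  proof -
    show "finite N"
      unfolding N_def by (rule finite_lists_sum_le)
    then show "finite X" "finite Y"
      unfolding X_def Y_def by (auto intro!: finite_permutations finite_SigmaI)
    then show "finite B"
      unfolding B_def by blast
  qed
  have sum_\<alpha>: "int (sum_list \<alpha>) = (\<Sum>i<k. int (\<alpha> ! i))"
    by (simp add: sum_list_sum_nth k_def atLeast0LessThan)
  have sum_map: "sum_list (map f [0..<k]) = (\<Sum>i<k. f i)" for f :: "nat \<Rightarrow> int"
    by (simp add: sum_list_sum_nth atLeast0LessThan)
  have last: "(\<Sum>i<k. int (\<sigma> i)) + int (\<sigma> k) = (\<Sum>i<k. int i) + int k"
    if "\<sigma> permutes {..<Suc k}" for \<sigma>
    using sum_image_permutes[OF that, of int] by simp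
  have "immaculate \<alpha> * H (int m) = (\<Sum>\<sigma>\<in>X. scale_nsym (of_int (sign \<sigma>)) (W (b \<sigma>)))"
    unfolding immaculate_def sum_distrib_right k_def[symmetric] X_def
  proof (rule sum.cong[OF refl])
    fix \<sigma> assume "\<sigma> \<in> {\<sigma>. \<sigma> permutes {..<k}}"
    \<comment> \<open>The shifts \<open>\<sigma> i - i\<close> cancel in the sum, so the last factor
      of \<open>W (b \<sigma>)\<close> is \<open>H m\<close>.\<close>
    then have "sum_list (b \<sigma>) = int (sum_list \<alpha>)"
      using sum_image_permutes[of \<sigma> k int]
      by (simp add: b_def sum_map sum_\<alpha> sum.distrib sum_subtractf)
    then show "scale_nsym (of_int (sign \<sigma>)) (H_vec (map (\<lambda>i. int (\<alpha> ! i) + int (\<sigma> i) - int i) [0..<k])) *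
        H (int m) = scale_nsym (of_int (sign \<sigma>)) (W (b \<sigma>))"
      by (simp add: W_def b_def scale_nsym_mult_left)
  qed
  also have "\<dots> = (\<Sum>y\<in>B. scale_nsym (\<Sum>\<sigma> | \<sigma> \<in> X \<and> b \<sigma> = y. of_int (sign \<sigma>)) (W y))"
    by (rule sum_group_by) (use finite in \<open>auto simp: B_def\<close>)
  also have "\<dots> = (\<Sum>y\<in>B. scale_nsym (\<Sum>x | x \<in> Y \<and> b' x = y. of_int (sign (snd x))) (W y))"
  proof (rule sum.cong[OF refl])
    fix y assume "y \<in> B"
    then have length_y: "length y = k"
      by (auto simp: B_def b_def b'_def)
    show "scale_nsym (\<Sum>\<sigma> | \<sigma> \<in> X \<and> b \<sigma> = y. of_int (sign \<sigma>)) (W y) =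
        scale_nsym (\<Sum>x | x \<in> Y \<and> b' x = y. of_int (sign (snd x))) (W y)"
    \<comment> \<open>If \<open>y\<close> alone exceeds the total degree, the last index is negative
      and \<open>W y\<close> vanishes; the coefficients are compared only in the other case.\<close>
    proof (cases "sum_list y \<le> int m + int (sum_list \<alpha>)")
      case False
      then have "W y = 0"
        by (simp add: W_def H_def)
      then show ?thesis
        by simp
    next
      case True
      \<comment> \<open>\<open>b \<sigma> = y\<close> means \<open>\<sigma> i = c i\<close>, and
        \<open>b' (ns, \<sigma>) = y\<close> means \<open>ns ! i + \<sigma> i = c i\<close>, for all
        \<open>i < k\<close>.\<close>
      define c where "c i = y ! i - int (\<alpha> ! i) + int i" for i
      have sum_c: "(\<Sum>i<k. c i) = sum_list y - int (sum_list \<alpha>) + (\<Sum>i<k. int i)"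
        using sum_map[of "\<lambda>i. y ! i"] map_nth[of y]
        by (simp add: c_def sum_\<alpha> sum.distrib sum_subtractf length_y)
      have "{\<sigma>. \<sigma> \<in> X \<and> b \<sigma> = y} = {\<sigma>. \<sigma> permutes {..<k} \<and> (\<forall>i<k. int (\<sigma> i) = c i)}"
        by (auto simp: X_def b_def c_def list_eq_iff_nth_eq length_y)
      then have "(\<Sum>\<sigma> | \<sigma> \<in> X \<and> b \<sigma> = y. of_int (sign \<sigma>)) =
          (of_int (\<Sum>\<sigma> | \<sigma> permutes {..<Suc k} \<and> (\<forall>i<k. int (\<sigma> i) \<le> c i). sign \<sigma>) :: rat)"
        by (simp add: sum_sign_permutes_below)
      also have "\<dots> = (\<Sum>x | x \<in> Y \<and> b' x = y. of_int (sign (snd x)))"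
        unfolding of_int_sum
      proof (rule sum.reindex_bij_witness[where i = snd and
            j = "\<lambda>\<sigma>. (map (\<lambda>i. nat (c i - int (\<sigma> i))) [0..<k], \<sigma>)"])
        fix \<sigma> assume "\<sigma> \<in> {\<sigma>. \<sigma> permutes {..<Suc k} \<and> (\<forall>i<k. int (\<sigma> i) \<le> c i)}"
        then have \<sigma>: "\<sigma> permutes {..<Suc k}" and le: "\<And>i. i < k \<Longrightarrow> int (\<sigma> i) \<le> c i"
          by auto
        let ?ns = "map (\<lambda>i. nat (c i - int (\<sigma> i))) [0..<k]"
        have "int (sum_list ?ns) = (\<Sum>i<k. int (nat (c i - int (\<sigma> i))))"
          by (simp add: sum_list_sum_nth atLeast0LessThan)
        also have "\<dots> = (\<Sum>i<k. c i - int (\<sigma> i))"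
          by (rule sum.cong) (auto simp: le)
        also have "\<dots> = sum_list y - int (sum_list \<alpha>) + int (\<sigma> k) - int k"
          using last[OF \<sigma>] by (simp add: sum_subtractf sum_c)
        \<comment> \<open>Combines the case assumption on \<open>y\<close> with
          \<open>\<sigma> k \<le> k\<close>.\<close>
        also have "\<dots> \<le> int m"
          using True permutes_in_image[OF \<sigma>, of k] by simp
        finally have "?ns \<in> N"
          by (simp add: N_def)
        moreover have "b' (?ns, \<sigma>) = y"
          using le by (auto simp: b'_def c_def length_y intro!: nth_equalityI)
        ultimately show "(?ns, \<sigma>) \<in> {x. x \<in> Y \<and> b' x = y}"
          using \<sigma> by (simp add: Y_def)
      next
        fix x assume "x \<in> {x. x \<in> Y \<and> b' x = y}"
        then obtain ns \<sigma> where x: "x = (ns, \<sigma>)" and ns: "ns \<in> N"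
          and \<sigma>: "\<sigma> permutes {..<Suc k}" and y: "b' (ns, \<sigma>) = y"
          by (auto simp: Y_def)
        have c: "c i = int (ns ! i) + int (\<sigma> i)" if "i < k" for i
          using that by (simp add: c_def b'_def flip: y)
        then show "snd x \<in> {\<sigma>. \<sigma> permutes {..<Suc k} \<and> (\<forall>i<k. int (\<sigma> i) \<le> c i)}"
          using \<sigma> by (simp add: x)
        show "(map (\<lambda>i. nat (c i - int (snd x i))) [0..<k], snd x) = x"
          using ns c by (auto simp: x N_def intro!: nth_equalityI)
      qed simp_all
      finally show ?thesis
        by simp
    qed
  qed
  also have "\<dots> = (\<Sum>x\<in>Y. scale_nsym (of_int (sign (snd x))) (W (b' x)))"
    by (rule sum_group_by[symmetric]) (use finite in \<open>auto simp: B_def\<close>)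
  also have "\<dots> = (\<Sum>ns\<in>N. \<Sum>\<sigma> | \<sigma> permutes {..<Suc k}.
      scale_nsym (of_int (sign \<sigma>)) (W (b' (ns, \<sigma>))))"
    unfolding Y_def by (simp add: sum.cartesian_product case_prod_beta)
  also have "\<dots> = (\<Sum>ns\<in>N. immaculate (map2 (+) \<alpha> ns @ (if sum_list ns < m then [m - sum_list ns] else [])))"
  proof (rule sum.cong[OF refl])
    fix ns assume "ns \<in> N"
    then have ns: "length ns = k" "sum_list ns \<le> m"
      by (simp_all add: N_def)
    let ?\<gamma> = "map2 (+) \<alpha> ns"
    have sum_ns: "int (sum_list ns) = (\<Sum>i<k. int (ns ! i))"
      using ns(1) by (simp add: sum_list_sum_nth atLeast0LessThan)
    have "length ?\<gamma> = k"
      using ns by (simp add: k_def)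
    \<comment> \<open>\<open>immaculate_snoc\<close> covers uniformly a new part of size
      \<open>m - sum_list ns\<close> and its absence when this is 0.\<close>
    then have "immaculate (?\<gamma> @ (if sum_list ns < m then [m - sum_list ns] else [])) =
        (\<Sum>\<sigma> | \<sigma> permutes {..<Suc k}. scale_nsym (of_int (sign \<sigma>))
          (H_vec (map (\<lambda>i. int (?\<gamma> ! i) + int (\<sigma> i) - int i) [0..<k]) *
           H (int (m - sum_list ns) + int (\<sigma> k) - int k)))"
      using immaculate_snoc[of ?\<gamma> "m - sum_list ns"] by simp
    also have "\<dots> = (\<Sum>\<sigma> | \<sigma> permutes {..<Suc k}. scale_nsym (of_int (sign \<sigma>)) (W (b' (ns, \<sigma>))))"
    proof (rule sum.cong[OF refl])
      fix \<sigma> assume "\<sigma> \<in> {\<sigma>. \<sigma> permutes {..<Suc k}}"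
      \<comment> \<open>A permutation preserves the sum of the positions, so the last index is the
        one forced by the total degree.\<close>
      then have "int (m - sum_list ns) + int (\<sigma> k) - int k =
          int m + int (sum_list \<alpha>) - sum_list (b' (ns, \<sigma>))"
        using last[of \<sigma>] ns
        by (simp add: b'_def sum_map sum_\<alpha> sum_ns sum.distrib sum_subtractf of_nat_diff)
      moreover have "map (\<lambda>i. int (?\<gamma> ! i) + int (\<sigma> i) - int i) [0..<k] = b' (ns, \<sigma>)"
        using ns by (simp add: b'_def k_def)
      ultimately show "scale_nsym (of_int (sign \<sigma>))
          (H_vec (map (\<lambda>i. int (?\<gamma> ! i) + int (\<sigma> i) - int i) [0..<k]) *
           H (int (m - sum_list ns) + int (\<sigma> k) - int k)) =
          scale_nsym (of_int (sign \<sigma>)) (W (b' (ns, \<sigma>)))"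
        by (simp add: W_def)
    qed
    finally show "(\<Sum>\<sigma> | \<sigma> permutes {..<Suc k}. scale_nsym (of_int (sign \<sigma>)) (W (b' (ns, \<sigma>)))) =
        immaculate (?\<gamma> @ (if sum_list ns < m then [m - sum_list ns] else []))" ..
  qed
  finally show ?thesis
    by (simp add: N_def k_def)
qed

section \<open>Shifting by a composition\<close>

lemma comp_add_Nil_right [simp]: "comp_add xs [] = xs"
  by (cases xs) auto

lemma length_comp_add [simp]: "length (comp_add xs ys) = max (length xs) (length ys)"
  by (induction xs ys rule: comp_add.induct) auto

lemma is_composition_comp_add:
  "is_composition xs \<Longrightarrow> is_composition ys \<Longrightarrow> is_composition (comp_add xs ys)"
  by (induction xs ys rule: comp_add.induct) (auto simp: is_composition_def)

text \<open>A new part created by the Pieri rule lies beyond the reach of \<open>v\<close>.\<close>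

lemma comp_add_append:
  "length ys \<le> length xs \<Longrightarrow> comp_add (xs @ zs) ys = comp_add xs ys @ zs"
  by (induction xs ys rule: comp_add.induct) auto

lemma comp_add_map2_plus:
  "length ns = length xs \<Longrightarrow> length ys \<le> length xs \<Longrightarrow>
   comp_add (map2 (+) xs ns) ys = map2 (+) (comp_add xs ys) ns"
proof (induction xs ys arbitrary: ns rule: comp_add.induct)
  case (3 x xs y ys)
  then show ?case
    by (cases ns) auto
qed auto

text \<open>A \<open>\<delta>\<close> shorter than \<open>v\<close> is padded with zeros at
  positions where \<open>\<gamma>\<close> has positive parts, so it cannot produce the same
  sum.\<close>

lemma comp_add_right_cancel:
  assumes "is_composition \<gamma>" "length v \<le> length \<gamma>"
  shows "comp_add \<delta> v = comp_add \<gamma> v \<longleftrightarrow> \<delta> = \<gamma>"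
  using assms
proof (induction v arbitrary: \<gamma> \<delta>)
  case (Cons x v)
  then show ?case
    by (cases \<gamma>; cases \<delta>) (auto simp: is_composition_def)
qed simp

text \<open>The span of the pairs \<open>(immaculate \<gamma>, immaculate (comp_add \<gamma> v))\<close>. The bound on \<open>length v\<close> makes
  \<open>\<gamma> \<mapsto> comp_add \<gamma> v\<close> injective.\<close>

inductive shift_span :: "nat list \<Rightarrow> nsym \<Rightarrow> nsym \<Rightarrow> bool" for v where
  zero: "shift_span v 0 0"
| step: "is_composition \<gamma> \<Longrightarrow> length v \<le> length \<gamma> \<Longrightarrow> shift_span v f g \<Longrightarrow>
    shift_span v (scale_nsym a (immaculate \<gamma>) + f) (scale_nsym a (immaculate (comp_add \<gamma> v)) + g)"

lemma shift_span_base: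
  assumes "is_composition \<gamma>" "length v \<le> length \<gamma>"
  shows "shift_span v (immaculate \<gamma>) (immaculate (comp_add \<gamma> v))"
  using shift_span.step[OF assms shift_span.zero, of 1] by simp

section \<open>Closure of the span under linear operations and right multiplication\<close>

lemma shift_span_add:
  "shift_span v f g \<Longrightarrow> shift_span v f' g' \<Longrightarrow> shift_span v (f + f') (g + g')"
  by (induction rule: shift_span.induct) (auto simp: add.assoc intro: shift_span.intros)

lemma shift_span_scale:
  "shift_span v f g \<Longrightarrow> shift_span v (scale_nsym a f) (scale_nsym a g)"
  by (induction rule: shift_span.induct)
    (auto simp: nsym.scale_right_distrib intro: shift_span.intros)

lemma shift_span_sum:
  "(\<And>x. x \<in> X \<Longrightarrow> shift_span v (f x) (g x)) \<Longrightarrow> shift_span v (sum f X) (sum g X)"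
  by (induction X rule: infinite_finite_induct) (auto intro: shift_span_add shift_span.zero)

text \<open>By linearity a single generating pair suffices. Since \<open>\<gamma>\<close> and
  \<open>comp_add \<gamma> v\<close> have equal length, the Pieri rule expands both products over
  the same increments, and matching terms again differ by \<open>v\<close>.\<close>

lemma shift_span_mult_H:
  assumes "shift_span v f g"
  shows "shift_span v (f * H m) (g * H m)"
  using assms
proof (induction rule: shift_span.induct)
  case (step \<gamma> f g a)
  have "shift_span v (immaculate \<gamma> * H m) (immaculate (comp_add \<gamma> v) * H m)"
  proof (cases "m < 0")
    case True
    then show ?thesis
      by (simp add: H_def shift_span.zero)
  next
    case False
    then obtain n where m: "m = int n"
      by (metis nonneg_int_cases not_less)
    have len: "length (comp_add \<gamma> v) = length \<gamma>"
      using step by simp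
    show ?thesis
      unfolding m immaculate_Pieri len
    proof (rule shift_span_sum)
      fix ns assume "ns \<in> {ns. length ns = length \<gamma> \<and> sum_list ns \<le> n}"
      then have ns: "length ns = length \<gamma>" "sum_list ns \<le> n"
        by simp_all
      let ?e = "if sum_list ns < n then [n - sum_list ns] else []"
      have "is_composition (map2 (+) \<gamma> ns @ ?e)"
        using step(1) by (auto simp: is_composition_def dest: set_zip_leftD)
      moreover have "comp_add (map2 (+) \<gamma> ns @ ?e) v = map2 (+) (comp_add \<gamma> v) ns @ ?e"
        using ns step by (simp add: comp_add_append comp_add_map2_plus)
      ultimately show "shift_span v (immaculate (map2 (+) \<gamma> ns @ ?e))
          (immaculate (map2 (+) (comp_add \<gamma> v) ns @ ?e))"
        using shift_span_base[of "map2 (+) \<gamma> ns @ ?e" v] ns step by auto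
    qed
  qed
  with step.IH show ?case
    by (simp add: distrib_right scale_nsym_mult_left shift_span_add shift_span_scale)
qed (simp add: shift_span.zero)

lemma shift_span_mult_H_vec:
  "shift_span v f g \<Longrightarrow> shift_span v (f * H_vec as) (g * H_vec as)"
proof (induction as arbitrary: f g)
  case (Cons a as)
  then show ?case
    using shift_span_mult_H[of v f g a] by (simp add: H_vec_def flip: mult.assoc)
qed (simp add: H_vec_def)

lemma shift_span_mult_immaculate:
  "shift_span v f g \<Longrightarrow> shift_span v (f * immaculate \<beta>) (g * immaculate \<beta>)"
  unfolding immaculate_def sum_distrib_left scale_nsym_mult_right
  by (intro shift_span_sum shift_span_scale shift_span_mult_H_vec)

text \<open>Both coefficient functions are built in parallel, the same scalar being added at
  \<open>\<gamma>\<close> and at \<open>comp_add \<gamma> v\<close>. Cancellation of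
  \<open>v\<close> ensures that no other index is shifted onto \<open>comp_add \<gamma> v\<close>,
  so the coefficients keep matching.\<close>

lemma shift_span_lincomb:
  assumes "shift_span v f g" and v: "is_composition v"
  shows "\<exists>c d. (\<forall>\<gamma>\<in>Poly_Mapping.keys c. is_composition \<gamma>) \<and> f = lincomb immaculate c \<and>
    (\<forall>\<gamma>\<in>Poly_Mapping.keys d. is_composition \<gamma>) \<and> g = lincomb immaculate d \<and>
    (\<forall>\<gamma>. Poly_Mapping.lookup d (comp_add \<gamma> v) = Poly_Mapping.lookup c \<gamma>)"
  using assms(1)
proof (induction rule: shift_span.induct)
  case zero
  show ?case
    by (intro exI[of _ 0]) simp
next
  case (step \<gamma> f g a)
  then obtain c d where IH: "\<forall>\<gamma>\<in>Poly_Mapping.keys c. is_composition \<gamma>" "f = lincomb immaculate c"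
    "\<forall>\<gamma>\<in>Poly_Mapping.keys d. is_composition \<gamma>" "g = lincomb immaculate d"
    "\<And>\<gamma>. Poly_Mapping.lookup d (comp_add \<gamma> v) = Poly_Mapping.lookup c \<gamma>"
    by blast
  let ?c = "Poly_Mapping.single \<gamma> a + c" and ?d = "Poly_Mapping.single (comp_add \<gamma> v) a + d"
  have "\<forall>\<delta>\<in>Poly_Mapping.keys ?c. is_composition \<delta>"
    using IH(1) step(1) keys_add[of "Poly_Mapping.single \<gamma> a" c] by (auto split: if_splits)
  moreover have "\<forall>\<delta>\<in>Poly_Mapping.keys ?d. is_composition \<delta>"
    using IH(3) is_composition_comp_add[OF step(1) v]
      keys_add[of "Poly_Mapping.single (comp_add \<gamma> v) a" d] by (auto split: if_splits)
  moreover have "Poly_Mapping.lookup ?d (comp_add \<delta> v) = Poly_Mapping.lookup ?c \<delta>" for \<delta>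
    using comp_add_right_cancel[OF step(1,2), of \<delta>] IH(5)
    by (auto simp: lookup_add lookup_single when_def)
  ultimately show ?case
    using IH(2,4) by (intro exI[of _ ?c] exI[of _ ?d]) (simp add: lincomb_add)
qed

theorem theorem4p1:
  fixes \<alpha> \<beta> \<gamma> v :: "nat list"
  assumes "is_composition \<alpha>" and "is_composition \<beta>"
    and "is_composition \<gamma>" and "is_composition v"
    and "length v \<le> length \<alpha>"
  shows "structure_const \<alpha> \<beta> \<gamma> = structure_const (comp_add \<alpha> v) \<beta> (comp_add \<gamma> v)"
proof -
  \<comment> \<open>The starting pair belongs to \<open>\<alpha>\<close> and
    \<open>comp_add \<alpha> v\<close>; here the bound on \<open>length v\<close> enters.\<close>
  have "shift_span v (immaculate \<alpha> * immaculate \<beta>) (immaculate (comp_add \<alpha> v) * immaculate \<beta>)"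
    using assms by (intro shift_span_mult_immaculate shift_span_base)
  \<comment> \<open>Both expansions run over compositions, so \<open>structure_const_eq\<close>
    identifies their coefficients with the structure constants.\<close>
  from shift_span_lincomb[OF this assms(4)] show ?thesis
    by (auto simp: structure_const_eq)
qed

end
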